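(* For every positive integer $k$, let $f(k)$ be the largest integer for which there exists $\varepsilon>0$ such that, for every $n$, every sequence of length $n$ either contains at least $f(k)$ distinct max-induced patterns on $k$ elements or contains a max-induced monotonic subsequence of length at least $n^{\varepsilon}$. Then $f(k)$ equals the number of $132$-avoiding permutations of $[k]$ (equivalently, the number of $231$-avoiding permutations of $[k]$), which is the Catalan number $C_k=\frac{1}{k+1}\binom{2k}{k}$.
   Context: Sequences are finite sequences with entries in a totally ordered set (e.g. the reals); entries may repeat. A sequence $(a_1,\dots,a_m)$ is monotonic if $a_1\le a_2\le\dots\le a_m$ or $a_1\ge a_2\ge\dots\ge a_m$. Two sequences $(a_1,\dots,a_t)$ and $(b_1,\dots,b_t)$ have the same pattern if for all $1\le i<j\le t$ we have $a_i>a_j$, $a_i=a_j$, $a_i<a_j$ if and only if $b_i>b_j$, $b_i=b_j$, $b_i<b_j$ respectively; a pattern is an equivalence class under this relation, and a pattern on $k$ elements is the class of a sequence of length $k$. A permutation avoids $132$ (resp. $231$) if no subsequence of it has the same pattern as $(1,3,2)$ (resp. $(2,3,1)$). A subsequence $(a_{i_1},\dots,a_{i_t})$, $i_1<\dots<i_t$, of $(a_1,\dots,a_m)$ is max-induced if for every $1\le j<t$ the maximum of $a_{i_j},a_{i_j+1},\dots,a_{i_{j+1}}$ is attained at $a_{i_j}$ or at $a_{i_{j+1}}$. A sequence contains a max-induced pattern $P$ if it has a max-induced subsequence with pattern $P$. *)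

theory Defs
  imports Complex_Main "HOL-Library.Sublist" "HOL-Combinatorics.Multiset_Permutations"
begin

definition monotonic :: "'a::linorder list \<Rightarrow> bool" where
  "monotonic xs \<longleftrightarrow> sorted_wrt (\<le>) xs \<or> sorted_wrt (\<ge>) xs"

definition same_pattern :: "'a::linorder list \<Rightarrow> 'b::linorder list \<Rightarrow> bool" where
  "same_pattern xs ys \<longleftrightarrow> length xs = length ys \<and>
     (\<forall>i j. i < j \<and> j < length xs \<longrightarrow>
        (xs ! i > xs ! j \<longleftrightarrow> ys ! i > ys ! j) \<and>
        (xs ! i = xs ! j \<longleftrightarrow> ys ! i = ys ! j) \<and>
        (xs ! i < xs ! j \<longleftrightarrow> ys ! i < ys ! j))"

definition pattern_rel :: "nat \<Rightarrow> ('a::linorder list \<times> 'a list) set" where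
  "pattern_rel k = {(xs, ys). length xs = k \<and> same_pattern xs ys}"

lemma equiv_pattern_rel: "equiv {xs :: 'a::linorder list. length xs = k} (pattern_rel k)"
  by (rule equivI) (auto simp: pattern_rel_def same_pattern_def refl_on_def sym_def trans_def)

definition patterns :: "nat \<Rightarrow> 'a::linorder list set set" where
  "patterns k = {xs. length xs = k} // pattern_rel k"

definition avoids :: "'a::linorder list \<Rightarrow> 'b::linorder list \<Rightarrow> bool" where
  "avoids xs q \<longleftrightarrow> \<not> (\<exists>ys. subseq ys xs \<and> same_pattern ys q)"

definition avoiding_perms :: "nat \<Rightarrow> nat list \<Rightarrow> nat list set" where
  "avoiding_perms k q = {p \<in> permutations_of_set {1..k}. avoids p q}"

text \<open>Whether a subsequence is max-induced depends on the positions it occupies and not only on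
  its entries, so a subsequence is given here by its increasing list of (0-based) positions.\<close>

definition subseq_positions :: "'a list \<Rightarrow> nat list \<Rightarrow> bool" where
  "subseq_positions xs is \<longleftrightarrow> sorted_wrt (<) is \<and> (\<forall>i \<in> set is. i < length xs)"

definition max_induced :: "'a::linorder list \<Rightarrow> nat list \<Rightarrow> bool" where
  "max_induced xs is \<longleftrightarrow> subseq_positions xs is \<and>
     (\<forall>j. Suc j < length is \<longrightarrow>
        Max ((\<lambda>l. xs ! l) ` {is ! j .. is ! Suc j}) \<in> {xs ! (is ! j), xs ! (is ! Suc j)})"

definition contains_max_induced_pattern :: "'a::linorder list \<Rightarrow> 'a list set \<Rightarrow> bool" where
  "contains_max_induced_pattern xs P \<longleftrightarrow>
     (\<exists>is. max_induced xs is \<and> map (\<lambda>i. xs ! i) is \<in> P)"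

text \<open>The type argument is the totally ordered set from which the entries of the sequences are
  taken.\<close>

definition guaranteed :: "'a::linorder itself \<Rightarrow> nat \<Rightarrow> nat \<Rightarrow> bool" where
  "guaranteed _ k m \<longleftrightarrow> (\<exists>\<epsilon>::real. \<epsilon> > 0 \<and>
     (\<forall>n. \<forall>xs :: 'a list. length xs = n \<longrightarrow>
        card {P \<in> patterns k. contains_max_induced_pattern xs P} \<ge> m \<or>
        (\<exists>is. max_induced xs is \<and> monotonic (map (\<lambda>i. xs ! i) is) \<and>
              real (length is) \<ge> real n powr \<epsilon>)))"

definition is_largest_guaranteed :: "'a::linorder itself \<Rightarrow> nat \<Rightarrow> nat \<Rightarrow> bool" where
  "is_largest_guaranteed T k f \<longleftrightarrow> guaranteed T k f \<and> (\<forall>m. guaranteed T k m \<longrightarrow> m \<le> f)"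

end

theory Submission
  imports Defs "HOL-Library.Tree" "HOL-Computational_Algebra.Formal_Power_Series"
    "HOL-Real_Asymp.Real_Asymp"
begin

text \<open>Arrange the positions of a sequence in a binary tree by putting the leftmost maximum at the root
  and recursing on both sides.  A set of positions that is closed under lowest common ancestors is
  max-induced, and the shape of its tree can be read off its pattern.  If a complete tree of height
  \<open>k\<close> embeds, then so do all \<open>C_k\<close> tree shapes with \<open>k\<close> nodes, which yields \<open>C_k\<close> patterns.  Otherwise
  the number of nodes is at most \<open>(L + R + 1) ^ k\<close>, where \<open>L\<close> and \<open>R\<close> are the largest numbers of left and
  right steps (counting the end node) along a branch; these are lengths of max-induced monotonic
  subsequences.

  Conversely, fill the complete binary tree of height \<open>d\<close> so that in every subtree all values on the left
  of the root exceed those on the right.  The resulting sequence of length \<open>2 ^ d - 1\<close> avoids \<open>132\<close>, so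
  the patterns of its subsequences are those of \<open>132\<close>-avoiding permutations, while its max-induced
  monotonic subsequences have length at most \<open>d\<close>.\<close>

section \<open>Patterns and standardization\<close>

text \<open>Using \<open><\<close> on both \<open>(i, j)\<close> and \<open>(j, i)\<close> recovers
  all three comparisons by trichotomy, so later proofs only have to compare strict
  inequalities.\<close>

lemma same_pattern_iff_less:
  "same_pattern xs ys \<longleftrightarrow> length xs = length ys \<and>
     (\<forall>i<length xs. \<forall>j<length xs. xs ! i < xs ! j \<longleftrightarrow> ys ! i < ys ! j)" (is "?L \<longleftrightarrow> ?R")
proof
  assume L: ?L
  show ?R
  proof (intro conjI allI impI)
    show "length xs = length ys" using L by (simp add: same_pattern_def)
    fix i j assume "i < length xs" "j < length xs"
    then show "xs ! i < xs ! j \<longleftrightarrow> ys ! i < ys ! j"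
      using L unfolding same_pattern_def by (cases i j rule: linorder_cases) auto
  qed
next
  assume R: ?R
  show ?L
    unfolding same_pattern_def
  proof (intro conjI allI impI)
    show "length xs = length ys" using R by simp
    fix i j assume "i < j \<and> j < length xs"
    then have "xs ! i < xs ! j \<longleftrightarrow> ys ! i < ys ! j" "xs ! j < xs ! i \<longleftrightarrow> ys ! j < ys ! i"
      using R by auto
    then show "xs ! i > xs ! j \<longleftrightarrow> ys ! i > ys ! j" "xs ! i = xs ! j \<longleftrightarrow> ys ! i = ys ! j"
      "xs ! i < xs ! j \<longleftrightarrow> ys ! i < ys ! j"
      by auto
  qed
qed

lemma same_pattern_refl: "same_pattern xs xs"
  by (simp add: same_pattern_iff_less)

lemma same_pattern_sym: "same_pattern xs ys \<Longrightarrow> same_pattern ys xs"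
  by (auto simp: same_pattern_iff_less)

lemma same_pattern_trans: "same_pattern xs ys \<Longrightarrow> same_pattern ys zs \<Longrightarrow> same_pattern xs zs"
  by (auto simp: same_pattern_iff_less)

lemma same_pattern_length: "same_pattern xs ys \<Longrightarrow> length xs = length ys"
  by (simp add: same_pattern_def)

lemma same_pattern_rev: "same_pattern xs ys \<Longrightarrow> same_pattern (rev xs) (rev ys)"
  by (auto simp: same_pattern_iff_less rev_nth)

lemma same_pattern_appendD:
  assumes "same_pattern (xs @ ys) (xs' @ ys')" "length xs = length xs'"
  shows "same_pattern xs xs'" "same_pattern ys ys'"
proof -
  have *: "(xs @ ys) ! i < (xs @ ys) ! j \<longleftrightarrow> (xs' @ ys') ! i < (xs' @ ys') ! j"
    if "i < length xs + length ys" "j < length xs + length ys" for i j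
    using assms that by (simp add: same_pattern_iff_less)
  have l: "length ys = length ys'" using assms by (simp add: same_pattern_def)
  show "same_pattern xs xs'"
    unfolding same_pattern_iff_less
  proof (intro conjI allI impI)
    fix i j assume "i < length xs" "j < length xs"
    then show "xs ! i < xs ! j \<longleftrightarrow> xs' ! i < xs' ! j"
      using *[of i j] assms(2) by (simp add: nth_append)
  qed (rule assms(2))
  show "same_pattern ys ys'"
    unfolding same_pattern_iff_less
  proof (intro conjI allI impI)
    fix i j assume "i < length ys" "j < length ys"
    then show "ys ! i < ys ! j \<longleftrightarrow> ys' ! i < ys' ! j"
      using *[of "length xs + i" "length xs + j"] assms(2) by (simp add: nth_append)
  qed (rule l)
qed

section \<open>Subsequences as lists of positions, and pattern avoidance\<close>

lemma subseq_positions_Cons: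
  assumes "subseq_positions (x # xs) (i # is)"
  obtains js where "subseq_positions xs js" "is = map Suc js"
proof
  have pos: "0 < j" if "j \<in> set is" for j
    using assms that by (fastforce simp: subseq_positions_def)
  show "is = map Suc (map (\<lambda>j. j - 1) is)"
    using pos by (simp add: map_idI)
  show "subseq_positions xs (map (\<lambda>j. j - 1) is)"
    using assms pos by (fastforce simp: subseq_positions_def sorted_wrt_map
      elim: sorted_wrt_mono_rel[rotated])
qed

text \<open>Links avoidance, which is stated with \<open>subseq\<close>, to the positional encoding
  on which \<open>max_induced\<close> is based.\<close>

lemma subseq_iff_positions:
  "subseq ys xs \<longleftrightarrow> (\<exists>is. subseq_positions xs is \<and> ys = map ((!) xs) is)"
proof
  assume "subseq ys xs"
  then show "\<exists>is. subseq_positions xs is \<and> ys = map ((!) xs) is"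
  proof (induction rule: list_emb.induct)
    case (list_emb_Nil ys)
    then show ?case by (auto simp: subseq_positions_def)
  next
    case (list_emb_Cons xs ys y)
    then obtain "is" where "subseq_positions ys is" "xs = map ((!) ys) is" by blast
    then show ?case
      by (intro exI[of _ "map Suc is"]) (auto simp: subseq_positions_def sorted_wrt_map)
  next
    case (list_emb_Cons2 x y xs ys)
    then obtain "is" where "subseq_positions ys is" "xs = map ((!) ys) is" by blast
    then show ?case using list_emb_Cons2
      by (intro exI[of _ "0 # map Suc is"]) (auto simp: subseq_positions_def sorted_wrt_map)
  qed
next
  assume "\<exists>is. subseq_positions xs is \<and> ys = map ((!) xs) is"
  then show "subseq ys xs"
  proof (induction xs arbitrary: ys)
    case Nil
    then show ?case by (auto simp: subseq_positions_def)
  next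
    case (Cons x xs)
    then obtain "is" where i: "subseq_positions (x # xs) is" and ys: "ys = map ((!) (x # xs)) is"
      by blast
    have shifted: "subseq (map ((!) (x # xs)) (map Suc js)) xs" if "subseq_positions xs js" for js
      using Cons.IH that by (auto simp: comp_def)
    show ?case
    proof (cases "is")
      case (Cons j js)
      obtain ks where ks: "subseq_positions xs ks" "js = map Suc ks"
        using subseq_positions_Cons i Cons by metis
      show ?thesis
      proof (cases j)
        case 0
        then show ?thesis using shifted[OF ks(1)] ks ys Cons by simp
      next
        case (Suc j')
        have "subseq_positions xs (j' # ks)"
          using i Cons Suc ks by (auto simp: subseq_positions_def sorted_wrt_map)
        from shifted[OF this] have "subseq ys xs" using ys Cons Suc ks by simp
        then show ?thesis by (rule list_emb.list_emb_Cons)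
      qed
    qed (use ys in auto)
  qed
qed

text \<open>Only two comparisons are needed, since the third one follows by transitivity. This form
  can be checked directly against a labelling of a tree.\<close>

lemma avoids_132_iff:
  "avoids xs [1, 3, 2::nat] \<longleftrightarrow>
     \<not> (\<exists>i j l. i < j \<and> j < l \<and> l < length xs \<and> xs ! i < xs ! l \<and> xs ! l < xs ! j)"
proof -
  have iff: "same_pattern [x, y, z] [1, 3, 2::nat] \<longleftrightarrow> x < z \<and> z < y" for x y z :: 'a
    by (auto simp: same_pattern_iff_less less_Suc_eq All_less_Suc2 numeral_eq_Suc)
  show ?thesis
  proof (intro iffI notI)
    assume av: "avoids xs [1, 3, 2::nat]"
      and "\<exists>i j l. i < j \<and> j < l \<and> l < length xs \<and> xs ! i < xs ! l \<and> xs ! l < xs ! j"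
    then obtain i j l where "i < j" "j < l" "l < length xs" "xs ! i < xs ! l" "xs ! l < xs ! j"
      by blast
    moreover from this have "subseq (map ((!) xs) [i, j, l]) xs"
      unfolding subseq_iff_positions by (intro exI[of _ "[i, j, l]"]) (auto simp: subseq_positions_def)
    ultimately show False
      using av iff unfolding avoids_def by auto
  next
    assume no: "\<not> (\<exists>i j l. i < j \<and> j < l \<and> l < length xs \<and> xs ! i < xs ! l \<and> xs ! l < xs ! j)"
    show "avoids xs [1, 3, 2::nat]"
      unfolding avoids_def
    proof
      assume "\<exists>ys. subseq ys xs \<and> same_pattern ys [1, 3, 2::nat]"
      then obtain "is" where i: "subseq_positions xs is" "same_pattern (map ((!) xs) is) [1, 3, 2::nat]"
        by (auto simp: subseq_iff_positions)
      then have "length is = 3" using same_pattern_length by fastforce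
      then obtain i j l where "is = [i, j, l]"
        by (auto simp: numeral_eq_Suc length_Suc_conv)
      then show False using i no iff by (auto simp: subseq_positions_def)
    qed
  qed
qed

lemma subseq_rev: "subseq xs ys \<Longrightarrow> subseq (rev xs) (rev ys)"
  by (induction rule: list_emb.induct) (auto intro: subseq_rev_drop_many)

lemma avoids_rev: "avoids (rev xs) (rev q) \<longleftrightarrow> avoids xs q"
proof -
  have "avoids xs q" if "avoids (rev xs) (rev q)" for xs :: "'a list" and q :: "'b list"
    using that subseq_rev same_pattern_rev unfolding avoids_def by blast
  from this[of xs q] this[of "rev xs" "rev q"] show ?thesis by auto
qed

lemma finite_avoiding_perms: "finite (avoiding_perms k q)"
  by (simp add: avoiding_perms_def)

text \<open>Reversal is an involution on permutations and carries occurrences of \<open>q\<close> to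
  occurrences of \<open>rev q\<close>.\<close>

lemma card_avoiding_perms_rev: "card (avoiding_perms k (rev q)) = card (avoiding_perms k q)"
proof -
  have "avoiding_perms k (rev q) = rev ` avoiding_perms k q"
  proof (intro equalityI subsetI)
    fix p assume "p \<in> avoiding_perms k (rev q)"
    then have "rev p \<in> avoiding_perms k q"
      using avoids_rev[of "rev p" q] unfolding avoiding_perms_def permutations_of_set_def
      unfolding rev_rev_ident mem_Collect_eq set_rev distinct_rev by blast
    then show "p \<in> rev ` avoiding_perms k q"
      by (intro image_eqI[of _ _ "rev p"]) simp_all
  next
    fix p assume "p \<in> rev ` avoiding_perms k q"
    then obtain p' where "p = rev p'" "p' \<in> avoiding_perms k q" by blast
    then show "p \<in> avoiding_perms k (rev q)"
      using avoids_rev[of p' q] unfolding avoiding_perms_def permutations_of_set_def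
      unfolding mem_Collect_eq by (metis set_rev distinct_rev)
  qed
  then show ?thesis by (simp add: card_image)
qed

text \<open>Replaces entries by their ranks, a canonical representative of the pattern. Counting
  with \<open>\<le>\<close> makes ranks start at 1, so distinct entries give a permutation of
  \<open>{1..length xs}\<close>; equal entries share a rank.\<close>

definition standardize :: "'a::linorder list \<Rightarrow> nat list" where
  "standardize xs = map (\<lambda>i. card {j. j < length xs \<and> xs ! j \<le> xs ! i}) [0..<length xs]"

lemma standardize_cong: "same_pattern xs ys \<Longrightarrow> standardize xs = standardize ys"
  unfolding standardize_def same_pattern_iff_less not_less[symmetric]
  by (auto intro!: arg_cong[where f = card])

text \<open>In a permutation of \<open>{1..k}\<close> exactly \<open>x\<close> entries are at most
  \<open>x\<close>. With \<open>standardize_cong\<close>, permutations with the same pattern are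
  therefore equal.\<close>

lemma standardize_permutation:
  assumes "p \<in> permutations_of_set {1..k}"
  shows "standardize p = p"
proof (rule nth_equalityI)
  fix i assume "i < length (standardize p)"
  then have i: "i < length p" by (simp add: standardize_def)
  have p: "set p = {1..k}" "distinct p" using assms by (auto simp: permutations_of_set_def)
  have "(!) p ` {j. j < length p \<and> p ! j \<le> p ! i} = {x \<in> set p. x \<le> p ! i}"
    by (auto simp: in_set_conv_nth)
  also have "\<dots> = {1..p ! i}"
    using p i nth_mem[OF i] by auto
  finally have "card {j. j < length p \<and> p ! j \<le> p ! i} = card {1..p ! i}"
    using p(2) by (metis (mono_tags, lifting) card_image inj_on_nth mem_Collect_eq)
  then show "standardize p ! i = p ! i"
    using i by (simp add: standardize_def)
qed (simp add: standardize_def)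

lemma same_pattern_standardize: "same_pattern (standardize xs) xs"
proof -
  have "card {l. l < length xs \<and> xs ! l \<le> xs ! i} < card {l. l < length xs \<and> xs ! l \<le> xs ! j}
    \<longleftrightarrow> xs ! i < xs ! j" (is "card ?I < card ?J \<longleftrightarrow> _") if "i < length xs" "j < length xs" for i j
  proof (cases "xs ! i < xs ! j")
    case True
    then have "j \<in> ?J" "j \<notin> ?I" "?I \<subseteq> ?J" using that by auto
    then show ?thesis using True by (auto intro!: psubset_card_mono)
  next
    case False
    then have "card ?J \<le> card ?I" using that by (intro card_mono) auto
    then show ?thesis using False by simp
  qed
  then show ?thesis by (simp add: same_pattern_iff_less standardize_def)
qed

lemma standardize_in_permutations:
  assumes "distinct xs"
  shows "standardize xs \<in> permutations_of_set {1..length xs}"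
proof -
  have len: "length (standardize xs) = length xs" by (simp add: standardize_def)
  have "distinct (standardize xs)"
    using assms same_pattern_standardize[of xs] len
    by (auto simp: distinct_conv_nth same_pattern_iff_less) (metis linorder_neq_iff)
  moreover have "set (standardize xs) \<subseteq> {1..length xs}"
  proof
    fix x assume "x \<in> set (standardize xs)"
    then obtain i where i: "i < length xs" "x = card {j. j < length xs \<and> xs ! j \<le> xs ! i}"
      by (auto simp: standardize_def)
    have "x \<le> card {..<length xs}" unfolding i by (intro card_mono) auto
    moreover have "i \<in> {j. j < length xs \<and> xs ! j \<le> xs ! i}" using i by simp
    then have "x \<noteq> 0" unfolding i by (subst card_0_eq) auto
    ultimately show "x \<in> {1..length xs}" by auto
  qed
  ultimately show ?thesis
    using len by (simp add: permutations_of_set_def card_subset_eq distinct_card)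
qed

lemma avoids_same_pattern:
  assumes "same_pattern xs ys" "avoids ys q"
  shows "avoids xs q"
  unfolding avoids_def
proof
  assume "\<exists>zs. subseq zs xs \<and> same_pattern zs q"
  then obtain "is" where i: "subseq_positions xs is" "same_pattern (map ((!) xs) is) q"
    by (auto simp: subseq_iff_positions)
  have l: "length xs = length ys" using assms same_pattern_length by blast
  have "same_pattern (map ((!) ys) is) (map ((!) xs) is)"
    using i(1) assms(1) l by (simp add: same_pattern_iff_less subseq_positions_def)
  then have "same_pattern (map ((!) ys) is) q" using i(2) same_pattern_trans by blast
  moreover have "subseq (map ((!) ys) is) ys"
    using i(1) l by (auto simp: subseq_iff_positions subseq_positions_def)
  ultimately show False using assms(2) unfolding avoids_def by blast
qed

lemma avoids_subseq: "subseq xs ys \<Longrightarrow> avoids ys q \<Longrightarrow> avoids xs q"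
  unfolding avoids_def using subseq_order.order_trans by blast

section \<open>Heaps with the leftmost maximum at the root\<close>

text \<open>The strict inequality on the left makes the tree unique when entries repeat.\<close>

fun max_heap :: "'a::linorder tree \<Rightarrow> bool" where
  "max_heap \<langle>\<rangle> \<longleftrightarrow> True"
| "max_heap \<langle>l, a, r\<rangle> \<longleftrightarrow>
     (\<forall>x\<in>set_tree l. x < a) \<and> (\<forall>x\<in>set_tree r. x \<le> a) \<and> max_heap l \<and> max_heap r"

abbreviation shape :: "'a tree \<Rightarrow> unit tree" where
  "shape \<equiv> map_tree (\<lambda>_. ())"

text \<open>Splitting at the first occurrence of the maximum makes the inequality on the left
  strict. The nodes carry positions and \<open>v\<close> supplies the values, so sets of nodes are
  sets of positions.\<close>

lemma max_heap_exists: "\<exists>t. inorder t = xs \<and> max_heap (map_tree v t)"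
proof (induction "length xs" arbitrary: xs rule: less_induct)
  case less
  show ?case
  proof (cases "xs = []")
    case False
    then have "Max (v ` set xs) \<in> v ` set xs" by simp
    then have "\<exists>x\<in>set xs. v x = Max (v ` set xs)" by auto
    then obtain ys a zs where xs: "xs = ys @ a # zs" and a: "v a = Max (v ` set xs)"
      and ys: "\<forall>y\<in>set ys. v y \<noteq> Max (v ` set xs)"
      using split_list_first_prop[of xs "\<lambda>x. v x = Max (v ` set xs)"] by blast
    have le: "v x \<le> v a" if "x \<in> set xs" for x
      using that a by simp
    obtain l r where "inorder l = ys" "max_heap (map_tree v l)"
        "inorder r = zs" "max_heap (map_tree v r)"
      using less[of ys] less[of zs] xs by auto
    moreover from this have "set_tree l = set ys" "set_tree r = set zs"
      by (metis set_inorder)+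
    moreover have "v x < v a" if "x \<in> set ys" for x
      proof (rule le_neq_trans)
      show "v x \<le> v a" using le that xs by simp
      show "v x \<noteq> v a" using ys that unfolding a by blast
    qed
    moreover have "v x \<le> v a" if "x \<in> set zs" for x
      using le[of x] that xs by simp
    ultimately have "inorder \<langle>l, a, r\<rangle> = xs \<and> max_heap (map_tree v \<langle>l, a, r\<rangle>)"
      unfolding xs by (simp add: tree.set_map)
    then show ?thesis by blast
  qed simp
qed

lemma max_heap_root:
  assumes "max_heap \<langle>l, a, r\<rangle>"
  shows "i < size l \<Longrightarrow> inorder \<langle>l, a, r\<rangle> ! i < a"
    and "size l \<le> i \<Longrightarrow> i < size \<langle>l, a, r\<rangle> \<Longrightarrow> inorder \<langle>l, a, r\<rangle> ! i \<le> a"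
    and "inorder \<langle>l, a, r\<rangle> ! size l = a"
proof -
  show "inorder \<langle>l, a, r\<rangle> ! i < a" if "i < size l"
    using assms that nth_mem[of i "inorder l"] by (auto simp: nth_append)
  show "inorder \<langle>l, a, r\<rangle> ! size l = a"
    by (simp add: nth_append)
  show "inorder \<langle>l, a, r\<rangle> ! i \<le> a" if "size l \<le> i" "i < size \<langle>l, a, r\<rangle>"
  proof (cases "i = size l")
    case False
    then have "size l < i" using that(1) by simp
    then obtain d where d: "i = Suc (size l + d)"
      using less_imp_Suc_add by blast
    then have "inorder r ! d \<in> set_tree r"
      using that(2) nth_mem[of d "inorder r"] by simp
    moreover have "inorder \<langle>l, a, r\<rangle> ! i = inorder r ! d"
      by (simp add: d nth_append)
    ultimately show ?thesis using assms by simp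
  qed (simp add: nth_append)
qed

text \<open>The root sits at the leftmost maximum. Were it further left in the first tree, the
  second sequence would increase strictly from index \<open>size l\<close> to
  \<open>size l'\<close>, whereas the first has its maximum at \<open>size l\<close>.\<close>

lemma max_heap_root_position_le:
  assumes "max_heap \<langle>l, a, r\<rangle>" "max_heap \<langle>l', a', r'\<rangle>"
    and "same_pattern (inorder \<langle>l, a, r\<rangle>) (inorder \<langle>l', a', r'\<rangle>)"
  shows "size l' \<le> size l"
proof (rule ccontr)
  assume "\<not> size l' \<le> size l"
  then have less: "size l < size l'" by simp
  have len: "length (inorder \<langle>l, a, r\<rangle>) = length (inorder \<langle>l', a', r'\<rangle>)"
    using assms(3) by (rule same_pattern_length)
  have "inorder \<langle>l', a', r'\<rangle> ! size l < inorder \<langle>l', a', r'\<rangle> ! size l'"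
    using max_heap_root[OF assms(2)] less by metis
  then have "inorder \<langle>l, a, r\<rangle> ! size l < inorder \<langle>l, a, r\<rangle> ! size l'"
    using assms(3) less len unfolding same_pattern_iff_less by simp
  then show False
    using max_heap_root(2)[OF assms(1), of "size l'"] max_heap_root(3)[OF assms(1)] less len
    by (simp add: not_less)
qed

text \<open>The pattern fixes the index of the root, and the parts before and after it inherit equal
  patterns. Hence different shapes yield different patterns.\<close>

lemma max_heap_shape_unique:
  assumes "max_heap s" "max_heap t" "same_pattern (inorder s) (inorder t)"
  shows "shape s = shape t"
  using assms
proof (induction s arbitrary: t)
  case Leaf
  then show ?case using same_pattern_length by fastforce
next
  case (Node l a r)
  then obtain l' a' r' where t: "t = \<langle>l', a', r'\<rangle>"
    using same_pattern_length[OF Node.prems(3)] by (cases t) auto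
  have "size l = size l'"
    using max_heap_root_position_le Node.prems same_pattern_sym unfolding t by (metis le_antisym)
  then have "same_pattern (inorder l) (inorder l')" "same_pattern ([a] @ inorder r) ([a'] @ inorder r')"
    using Node.prems(3) same_pattern_appendD[of "inorder l" "[a] @ inorder r" "inorder l'" "[a'] @ inorder r'"]
    by (simp_all add: t)
  moreover from this(2) have "same_pattern (inorder r) (inorder r')"
    using same_pattern_appendD(2) by fastforce
  ultimately show ?case using Node by (simp add: t)
qed

lemma tree_eqI: "shape s = shape t \<Longrightarrow> inorder s = inorder t \<Longrightarrow> s = t"
proof (induction s arbitrary: t)
  case (Node l a r)
  then obtain l' a' r' where t: "t = \<langle>l', a', r'\<rangle>" by (cases t) auto
  have "size l = size l'"
    using Node.prems(1) by (metis t size_map_tree tree.inject tree.map(2))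
  then show ?case using Node by (auto simp: t)
qed simp

text \<open>On a search tree, this labelling with \<open>0, \<dots>, size t - 1\<close> puts the values of every left subtree
  above those of the right one.\<close>

fun val132 :: "'a::linorder tree \<Rightarrow> 'a \<Rightarrow> nat" where
  "val132 \<langle>\<rangle> i = 0"
| "val132 \<langle>l, a, r\<rangle> i =
     (if i < a then size r + val132 l i else if i = a then size l + size r else val132 r i)"

lemma val132_less: "bst t \<Longrightarrow> i \<in> set_tree t \<Longrightarrow> val132 t i < size t"
  by (induction t) fastforce+

lemma val132_Node:
  assumes "bst \<langle>l, a, r\<rangle>"
  shows "i \<in> set_tree l \<Longrightarrow> val132 \<langle>l, a, r\<rangle> i = size r + val132 l i"
    and "i \<in> set_tree r \<Longrightarrow> val132 \<langle>l, a, r\<rangle> i = val132 r i"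
    and "val132 \<langle>l, a, r\<rangle> a = size l + size r"
  using assms by auto

lemma val132_max_heap: "bst t \<Longrightarrow> max_heap (map_tree (val132 t) t)"
proof (induction t)
  case (Node l a r)
  note N = val132_Node[OF Node.prems]
  \<comment> \<open>Inside the left subtree the labels are those of \<open>val132 l\<close> shifted
    by \<open>size r\<close>, and a shift keeps the heap property.\<close>
  have eq: "map_tree (val132 \<langle>l, a, r\<rangle>) l = map_tree ((+) (size r)) (map_tree (val132 l) l)"
    "map_tree (val132 \<langle>l, a, r\<rangle>) r = map_tree (val132 r) r"
    unfolding tree.map_comp by (auto intro!: tree.map_cong simp: N simp del: val132.simps)
  have shift: "max_heap (map_tree ((+) n) t) \<longleftrightarrow> max_heap t" for n and t :: "nat tree"
    by (induction t) (auto simp: tree.set_map)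
  have h: "max_heap (map_tree (val132 \<langle>l, a, r\<rangle>) l)" "max_heap (map_tree (val132 \<langle>l, a, r\<rangle>) r)"
    unfolding eq shift using Node by auto
  have l: "val132 l i < size l" if "i \<in> set_tree l" for i using that val132_less Node.prems by auto
  have r: "val132 r i < size r" if "i \<in> set_tree r" for i using that val132_less Node.prems by auto
  have "val132 \<langle>l, a, r\<rangle> i < val132 \<langle>l, a, r\<rangle> a" if "i \<in> set_tree l \<union> set_tree r" for i
    using that N(1)[of i] N(2)[of i] N(3) l[of i] r[of i] by (auto simp del: val132.simps)
  with h show ?case
    unfolding tree.map max_heap.simps tree.set_map by (blast intro: less_imp_le)
qed simp

lemma val132_inj: "bst t \<Longrightarrow> inj_on (val132 t) (set_tree t)"
proof (induction t)
  case (Node l a r)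
  note N = val132_Node[OF Node.prems]
  have l: "val132 l i < size l" if "i \<in> set_tree l" for i using that val132_less Node.prems by auto
  have r: "val132 r i < size r" if "i \<in> set_tree r" for i using that val132_less Node.prems by auto
  have IH: "inj_on (val132 l) (set_tree l)" "inj_on (val132 r) (set_tree r)"
    using Node by auto
  have "inj_on (val132 \<langle>l, a, r\<rangle>) (set_tree l)"
  proof (rule inj_onI)
    fix i j assume "i \<in> set_tree l" "j \<in> set_tree l" "val132 \<langle>l, a, r\<rangle> i = val132 \<langle>l, a, r\<rangle> j"
    then show "i = j" using N(1) IH(1) by (metis add_left_cancel inj_onD)
  qed
  moreover have "inj_on (val132 \<langle>l, a, r\<rangle>) (set_tree r)"
  proof (rule inj_onI)
    fix i j assume "i \<in> set_tree r" "j \<in> set_tree r" "val132 \<langle>l, a, r\<rangle> i = val132 \<langle>l, a, r\<rangle> j"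
    then show "i = j" using N(2) IH(2) by (metis inj_onD)
  qed
  moreover have "val132 \<langle>l, a, r\<rangle> i \<noteq> val132 \<langle>l, a, r\<rangle> j"
    if "i \<in> set_tree l" "j \<in> set_tree r" for i j
    using N(1)[OF that(1)] N(2)[OF that(2)] r[OF that(2)] by linarith
  moreover have "val132 \<langle>l, a, r\<rangle> i \<noteq> val132 \<langle>l, a, r\<rangle> a" if "i \<in> set_tree l" for i
    using N(1)[OF that] N(3) l[OF that] by linarith
  moreover have "val132 \<langle>l, a, r\<rangle> i \<noteq> val132 \<langle>l, a, r\<rangle> a" if "i \<in> set_tree r" for i
    using N(2)[OF that] N(3) r[OF that] by linarith
  ultimately have "inj_on (val132 \<langle>l, a, r\<rangle>) (insert a (set_tree l \<union> set_tree r))"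
    unfolding inj_on_def by (metis Un_iff insert_iff)
  moreover have "set_tree \<langle>l, a, r\<rangle> = insert a (set_tree l \<union> set_tree r)" by auto
  ultimately show ?case by (simp only:)
qed simp

text \<open>The cases follow the last position \<open>k\<close>. If it is in the left subtree, so
  are \<open>i\<close> and \<open>j\<close>; if it is the root, its value is maximal; if it is in
  the right subtree and \<open>i\<close> is not, then \<open>i\<close> has the larger value.\<close>

lemma val132_avoids:
  assumes "bst t" "i \<in> set_tree t" "j \<in> set_tree t" "k \<in> set_tree t" "i < j" "j < k"
  shows "\<not> (val132 t i < val132 t k \<and> val132 t k < val132 t j)"
  using assms
proof (induction t)
  case (Node l a r)
  have l: "val132 l i < size l" "i < a" if "i \<in> set_tree l" for i
    using that val132_less Node.prems by auto
  have r: "val132 r i < size r" "a < i" if "i \<in> set_tree r" for i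
    using that val132_less Node.prems by auto
  have side: "x < a \<Longrightarrow> x \<in> set_tree l" "a < x \<Longrightarrow> x \<in> set_tree r"
    if "x \<in> set_tree \<langle>l, a, r\<rangle>" for x
    using that l(2)[of x] r(2)[of x] by auto
  note N = val132_Node[OF Node.prems(1)]
  consider "k \<in> set_tree l" | "k = a" | "k \<in> set_tree r" using Node.prems by auto
  then show ?case
  proof cases
    case 1
    have "j < a" using Node.prems(6) l(2)[OF 1] by (rule less_trans)
    moreover from Node.prems(5) this have "i < a" by (rule less_trans)
    ultimately have "i \<in> set_tree l" "j \<in> set_tree l" using side Node.prems(2,3) by blast+
    then show ?thesis using Node.IH(1) Node.prems 1 N(1) by simp
  next
    case 2
    then have "j \<in> set_tree l" using side Node.prems by auto
    then show ?thesis using 2 N(1)[of j] N(3) l(1)[of j] by simp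
  next
    case 3
    show ?thesis
    proof (cases "i \<in> set_tree r")
      case True
      have "a < j" using r(2)[OF True] Node.prems(5) by (rule less_trans)
      then have "j \<in> set_tree r" using side Node.prems(3) by blast
      then show ?thesis using Node.IH(2) Node.prems 3 True N(2) by simp
    next
      case False
      then consider "i = a" | "i \<in> set_tree l" using Node.prems(2) by auto
      then have "size r \<le> val132 \<langle>l, a, r\<rangle> i"
        by cases (use N in simp_all)
      then show ?thesis using N(2)[OF 3] r(1)[OF 3] by simp
    qed
  qed
qed simp

text \<open>The tree alone determines the order of the values of a 132-avoider: everything left of
  the root must exceed everything right of it, recursively, and this is how \<open>val132\<close> is
  built.\<close>

lemma avoiding_132_order_determined:
  assumes "bst t" "max_heap (map_tree v t)" "inj_on v (set_tree t)"
    and "\<And>i j k. i \<in> set_tree t \<Longrightarrow> j \<in> set_tree t \<Longrightarrow> k \<in> set_tree t \<Longrightarrow> i < j \<Longrightarrow> j < k \<Longrightarrow>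
           \<not> (v i < v k \<and> v k < v j)"
    and "i \<in> set_tree t" "j \<in> set_tree t"
  shows "v i < v j \<longleftrightarrow> val132 t i < val132 t j"
  using assms
proof (induction t arbitrary: i j)
  case (Node l a r)
  note N = val132_Node[OF Node.prems(1)]
  have l: "val132 l x < size l" "x < a" "v x < v a" if "x \<in> set_tree l" for x
    using that val132_less Node.prems(1,2) by (auto simp: tree.set_map)
  have r: "val132 r x < size r" "a < x" "v x < v a" if x: "x \<in> set_tree r" for x
  proof -
    show "val132 r x < size r" "a < x" using x val132_less Node.prems(1) by auto
    then have "v x \<noteq> v a" using Node.prems(3) x by (auto simp: inj_on_def)
    then show "v x < v a" using Node.prems(2) x by (intro le_neq_trans) (auto simp: tree.set_map)
  qed
  \<comment> \<open>Otherwise \<open>x\<close>, \<open>a\<close>, \<open>y\<close> would form the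
    pattern 132 with the root \<open>a\<close> as its largest entry.\<close>
  have lr: "v y < v x" if "x \<in> set_tree l" "y \<in> set_tree r" for x y
  proof -
    have "x \<noteq> y" using less_trans[OF l(2)[OF that(1)] r(2)[OF that(2)]] by blast
    then have "v x \<noteq> v y" using inj_onD[OF Node.prems(3), of x y] that by auto
    then show ?thesis
      using Node.prems(4)[of x a y] that l(2)[of x] r(2,3)[of y] by auto
  qed
  have IHl: "v x < v y \<longleftrightarrow> val132 l x < val132 l y" if "x \<in> set_tree l" "y \<in> set_tree l" for x y
  proof (rule Node.IH(1))
    show "inj_on v (set_tree l)" using Node.prems(3) by (rule inj_on_subset) auto
    show "\<not> (v i < v k \<and> v k < v j)"
      if "i \<in> set_tree l" "j \<in> set_tree l" "k \<in> set_tree l" "i < j" "j < k" for i j k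
      using Node.prems(4)[of i j k] that by simp
  qed (use Node.prems(1,2) that in simp_all)
  have IHr: "v x < v y \<longleftrightarrow> val132 r x < val132 r y" if "x \<in> set_tree r" "y \<in> set_tree r" for x y
  proof (rule Node.IH(2))
    show "inj_on v (set_tree r)" using Node.prems(3) by (rule inj_on_subset) auto
    show "\<not> (v i < v k \<and> v k < v j)"
      if "i \<in> set_tree r" "j \<in> set_tree r" "k \<in> set_tree r" "i < j" "j < k" for i j k
      using Node.prems(4)[of i j k] that by simp
  qed (use Node.prems(1,2) that in simp_all)
  consider "i \<in> set_tree l" | "i = a" | "i \<in> set_tree r" using Node.prems(5) by auto
  then show ?case
  proof cases
    case 1
    consider "j \<in> set_tree l" | "j = a" | "j \<in> set_tree r" using Node.prems(6) by auto
    then show ?thesis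
    proof cases
      case 1
      then show ?thesis using \<open>i \<in> set_tree l\<close> N(1) IHl by (metis add_less_cancel_left)
    next
      case 2
      then show ?thesis using l[OF \<open>i \<in> set_tree l\<close>] N(1)[OF \<open>i \<in> set_tree l\<close>] N(3) by simp
    next
      case 3
      then show ?thesis
        using lr[OF \<open>i \<in> set_tree l\<close> 3] r[OF 3] N(1)[OF \<open>i \<in> set_tree l\<close>] N(2)[OF 3] by simp
    qed
  next
    case 2
    consider "j \<in> set_tree l" | "j = a" | "j \<in> set_tree r" using Node.prems(6) by auto
    then show ?thesis
    proof cases
      case 1
      then show ?thesis using \<open>i = a\<close> l[OF 1] N(1)[OF 1] N(3) by simp
    next
      case 3
      then show ?thesis using \<open>i = a\<close> r[OF 3] N(2)[OF 3] N(3) by simp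
    qed (use 2 in simp)
  next
    case 3
    consider "j \<in> set_tree l" | "j = a" | "j \<in> set_tree r" using Node.prems(6) by auto
    then show ?thesis
    proof cases
      case 1
      then show ?thesis
        using lr[OF 1 \<open>i \<in> set_tree r\<close>] r[OF \<open>i \<in> set_tree r\<close>] N(1)[OF 1] N(2)[OF \<open>i \<in> set_tree r\<close>]
        by simp
    next
      case 2
      then show ?thesis using r[OF \<open>i \<in> set_tree r\<close>] N(2)[OF \<open>i \<in> set_tree r\<close>] N(3) by simp
    next
      case 3
      then show ?thesis using \<open>i \<in> set_tree r\<close> N(2) IHr by metis
    qed
  qed
qed simp

section \<open>Counting 132-avoiding permutations\<close>

lemma bst_upt: "inorder t = [a..<b] \<Longrightarrow> bst t"
  by (simp add: bst_iff_sorted_wrt_less)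

lemma set_tree_upt: "inorder t = [a..<b] \<Longrightarrow> set_tree t = {a..<b}"
  by (metis set_inorder set_upt)

lemma avoids_val132:
  assumes "inorder t = [0..<k]"
  shows "avoids (map (val132 t) [0..<k]) [1, 3, 2::nat]"
  using val132_avoids[OF bst_upt[OF assms]]
  unfolding avoids_132_iff set_tree_upt[OF assms] by (auto simp del: upt_Suc)

text \<open>On a search tree \<open>val132\<close> already takes the values
  \<open>0, ..., size t - 1\<close> once each; \<open>standardize\<close> moves them to
  \<open>1, ..., size t\<close>.\<close>

definition tree_perm :: "nat tree \<Rightarrow> nat list" where
  "tree_perm t = standardize (map (val132 t) (inorder t))"

lemma tree_perm_in_avoiding_perms:
  assumes "inorder t = [0..<k]"
  shows "tree_perm t \<in> avoiding_perms k [1, 3, 2]"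
proof -
  have "distinct (map (val132 t) [0..<k])"
    using val132_inj[OF bst_upt[OF assms]] set_tree_upt[OF assms] by (simp add: distinct_map)
  from standardize_in_permutations[OF this] have "tree_perm t \<in> permutations_of_set {1..k}"
    by (simp add: tree_perm_def assms)
  moreover have "avoids (tree_perm t) [1, 3, 2::nat]"
    unfolding tree_perm_def assms
    by (rule avoids_same_pattern[OF same_pattern_standardize avoids_val132[OF assms]])
  ultimately show ?thesis by (simp add: avoiding_perms_def)
qed

text \<open>The permutation has the pattern of a max-heap traversal, which determines the shape; the
  shape and the common traversal \<open>[0..<k]\<close> determine the tree.\<close>

lemma inj_on_tree_perm: "inj_on tree_perm {t. inorder t = [0..<k]}"
proof (rule inj_onI)
  fix s t assume "s \<in> {t. inorder t = [0..<k]}" "t \<in> {t. inorder t = [0..<k]}"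
    and eq: "tree_perm s = tree_perm t"
  then have s: "inorder s = [0..<k]" and t: "inorder t = [0..<k]" by auto
  have "same_pattern (map (val132 s) (inorder s)) (map (val132 t) (inorder t))"
    using same_pattern_trans[OF same_pattern_sym[OF same_pattern_standardize]]
      same_pattern_standardize eq unfolding tree_perm_def by metis
  then have "shape (map_tree (val132 s) s) = shape (map_tree (val132 t) t)"
    using max_heap_shape_unique[OF val132_max_heap val132_max_heap] bst_upt[OF s] bst_upt[OF t]
    by (simp add: inorder_map)
  then have "shape s = shape t"
    by (simp add: tree.map_comp comp_def)
  then show "s = t"
    using s t by (auto intro: tree_eqI[of s t])
qed

text \<open>The preimage of \<open>p\<close> is the max-heap on its positions: by avoidance,
  \<open>p\<close> and \<open>val132\<close> order these positions alike, so their standardizations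
  agree.\<close>

lemma avoiding_perms_subset_tree_perm:
  assumes "p \<in> avoiding_perms k [1, 3, 2]"
  shows "p \<in> tree_perm ` {t. inorder t = [0..<k]}"
proof -
  have p: "p \<in> permutations_of_set {1..k}" "avoids p [1, 3, 2::nat]"
    using assms by (auto simp: avoiding_perms_def)
  have len: "length p = k" and dist: "distinct p"
    using p(1) length_finite_permutations_of_set permutations_of_setD by fastforce+
  obtain t where t: "inorder t = [0..<k]" "max_heap (map_tree ((!) p) t)"
    using max_heap_exists by blast
  have "p ! i < p ! j \<longleftrightarrow> val132 t i < val132 t j" if "i < k" "j < k" for i j
  proof (rule avoiding_132_order_determined)
    show "inj_on ((!) p) (set_tree t)"
      using dist len by (simp add: set_tree_upt[OF t(1)] inj_on_nth)
    show "\<not> (p ! i < p ! l \<and> p ! l < p ! j)"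
      if "i \<in> set_tree t" "j \<in> set_tree t" "l \<in> set_tree t" "i < j" "j < l" for i j l
      using p(2) that len unfolding avoids_132_iff set_tree_upt[OF t(1)] by auto
  qed (use bst_upt[OF t(1)] t(2) set_tree_upt[OF t(1)] that in auto)
  then have "same_pattern p (map (val132 t) (inorder t))"
    using len t(1) by (simp add: same_pattern_iff_less)
  then have "p = tree_perm t"
    using standardize_cong standardize_permutation[OF p(1)] unfolding tree_perm_def by metis
  then show ?thesis using t(1) by blast
qed

lemma card_avoiding_perms_132: "card (avoiding_perms k [1, 3, 2]) = card {t. inorder t = [0..<k]}"
proof -
  have "avoiding_perms k [1, 3, 2] = tree_perm ` {t. inorder t = [0..<k]}"
    using avoiding_perms_subset_tree_perm tree_perm_in_avoiding_perms by blast
  then show ?thesis by (simp add: card_image inj_on_tree_perm)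
qed

section \<open>Catalan numbers: recurrence, counting of trees, closed form\<close>

fun catalan :: "nat \<Rightarrow> nat" where
  "catalan 0 = 1"
| "catalan (Suc n) = (\<Sum>i\<le>n. catalan i * catalan (n - i))"

lemma trees_decomp:
  assumes "xs \<noteq> []"
  shows "{t. inorder t = xs} = (\<Union>i<length xs. (\<lambda>(l, r). \<langle>l, xs ! i, r\<rangle>) `
           ({l. inorder l = take i xs} \<times> {r. inorder r = drop (Suc i) xs}))" (is "?A = ?B")
proof (intro equalityI subsetI)
  fix t assume "t \<in> ?A"
  then obtain l a r where t: "t = \<langle>l, a, r\<rangle>" and xs: "xs = inorder l @ a # inorder r"
    using assms by (cases t) auto
  have "size l < length xs" "inorder l = take (size l) xs" "a = xs ! size l"
    "inorder r = drop (Suc (size l)) xs"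
    unfolding xs by (simp_all add: nth_append)
  then show "t \<in> ?B" unfolding t
    by (intro UN_I[of "size l"] image_eqI[where x = "(l, r)"]) simp_all
next
  fix t assume "t \<in> ?B"
  then obtain i l r where i: "i < length xs" and t: "t = \<langle>l, xs ! i, r\<rangle>"
    and "inorder l = take i xs" "inorder r = drop (Suc i) xs" by auto
  then have "inorder t = take i xs @ xs ! i # drop (Suc i) xs" by simp
  then show "t \<in> ?A" using id_take_nth_drop[OF i] by simp
qed

lemma finite_trees_inorder: "finite {t. inorder t = xs}"
proof (induction "length xs" arbitrary: xs rule: less_induct)
  case less
  show ?case
  proof (cases "xs = []")
    case False
    then show ?thesis
      using less unfolding trees_decomp[OF False]
      by (intro finite_UN_I finite_imageI finite_cartesian_product) auto
  qed simp
qed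

text \<open>Splitting by the index of the root gives the recurrence of \<open>catalan\<close>.
  Entries of \<open>xs\<close> may repeat, so the count serves both for \<open>[0..<k]\<close> and
  for bare shapes, where the list is \<open>replicate k ()\<close>.\<close>

lemma card_trees_inorder: "card {t. inorder t = xs} = catalan (length xs)"
proof (induction "length xs" arbitrary: xs rule: less_induct)
  case less
  show ?case
  proof (cases "length xs")
    case (Suc n)
    then have ne: "xs \<noteq> []" by auto
    have "card {t. inorder t = xs} = (\<Sum>i<length xs. card ((\<lambda>(l, r). \<langle>l, xs ! i, r\<rangle>) `
            ({l. inorder l = take i xs} \<times> {r. inorder r = drop (Suc i) xs})))"
      unfolding trees_decomp[OF ne]
    proof (rule card_UN_disjoint)
      show "\<forall>i\<in>{..<length xs}. \<forall>j\<in>{..<length xs}. i \<noteq> j \<longrightarrow>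
        (\<lambda>(l, r). \<langle>l, xs ! i, r\<rangle>) ` ({l. inorder l = take i xs} \<times> {r. inorder r = drop (Suc i) xs}) \<inter>
        (\<lambda>(l, r). \<langle>l, xs ! j, r\<rangle>) ` ({l. inorder l = take j xs} \<times> {r. inorder r = drop (Suc j) xs}) = {}"
      proof (intro ballI impI)
        fix i j assume ij: "i \<in> {..<length xs}" "j \<in> {..<length xs}" "i \<noteq> j"
        \<comment> \<open>Trees with different root indices differ already in the length of the
          traversal of the left subtree.\<close>
        have "take i xs \<noteq> take j xs"
        proof
          assume "take i xs = take j xs"
          then have "length (take i xs) = length (take j xs)" by simp
          then show False using ij by simp
        qed
        then show "(\<lambda>(l, r). \<langle>l, xs ! i, r\<rangle>) ` ({l. inorder l = take i xs} \<times> {r. inorder r = drop (Suc i) xs}) \<inter>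
          (\<lambda>(l, r). \<langle>l, xs ! j, r\<rangle>) ` ({l. inorder l = take j xs} \<times> {r. inorder r = drop (Suc j) xs}) = {}"
          by auto
      qed
    qed (simp_all add: finite_trees_inorder)
    also have "\<dots> = (\<Sum>i<length xs. card {l. inorder l = take i xs} * card {r. inorder r = drop (Suc i) xs})"
      by (intro sum.cong refl, subst card_image) (auto simp: inj_on_def card_cartesian_product)
    also have "\<dots> = (\<Sum>i<length xs. catalan i * catalan (length xs - Suc i))"
      by (intro sum.cong refl) (simp add: less)
    also have "\<dots> = catalan (length xs)"
      by (simp add: Suc lessThan_Suc_atMost)
    finally show ?thesis .
  qed simp
qed

text \<open>Up to the factor \<open>-2\<close> and a shift of the index, the Catalan numbers are the coefficients of
  \<open>(1 - 4 x) powr (1/2)\<close>, whose square has no terms of degree greater than \<open>1\<close>.\<close>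

lemma catalan_gbinomial: "real (catalan n) = (1/2 gchoose Suc n) * (-4) ^ Suc n / (-2)"
proof (induction n rule: less_induct)
  case (less n)
  define h where "h i = (1/2 gchoose i) * (-4::real) ^ i" for i
  show ?case
  proof (cases n)
    case 0
    then show ?thesis by simp
  next
    case (Suc m)
    have "(\<Sum>i\<in>{0..Suc n}. h i * h (Suc n - i))
        = (-4) ^ Suc n * (\<Sum>i\<in>{0..Suc n}. (1/2 gchoose i) * (1/2 gchoose (Suc n - i)))"
      unfolding sum_distrib_left h_def
      by (intro sum.cong refl) (simp add: mult_ac flip: power_add)
    \<comment> \<open>By Vandermonde the convolution is \<open>1 gchoose Suc n\<close>, because 1/2
      + 1/2 = 1; it vanishes since \<open>n\<close> is positive here.\<close>
    also have "\<dots> = 0"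
      unfolding gbinomial_Vandermonde using Suc binomial_gbinomial[of 1 "Suc n", where 'a = real]
      by simp
    finally have "0 = (\<Sum>i\<in>{0..Suc (Suc m)}. h i * h (Suc (Suc m) - i))" by (simp add: Suc)
    \<comment> \<open>Both end terms equal \<open>h (Suc n)\<close> because \<open>h 0 = 1\<close>;
      the inner terms become the Catalan convolution by the induction hypothesis.\<close>
    also have "\<dots> = 2 * h (Suc n) + (\<Sum>i\<in>{0..m}. h (Suc i) * h (Suc (m - i)))"
    proof -
      have split: "(\<Sum>i\<in>{0..Suc (Suc m)}. g i) = g 0 + (\<Sum>i\<in>{0..m}. g (Suc i)) + g (Suc (Suc m))"
        for g :: "nat \<Rightarrow> real"
        by (subst sum.atLeast0_atMost_Suc, subst sum.atLeast0_atMost_Suc_shift) simp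
      moreover have "h 0 = 1" by (simp add: h_def)
      moreover have "(\<Sum>i\<in>{0..m}. h (Suc i) * h (Suc m - i)) = (\<Sum>i\<in>{0..m}. h (Suc i) * h (Suc (m - i)))"
        by (intro sum.cong refl) (simp add: Suc_diff_le)
      ultimately show ?thesis unfolding split by (simp add: Suc)
    qed
    also have "(\<Sum>i\<in>{0..m}. h (Suc i) * h (Suc (m - i))) = (\<Sum>i\<in>{0..m}. 4 * (real (catalan i) * real (catalan (m - i))))"
    proof (intro sum.cong refl)
      fix i assume "i \<in> {0..m}"
      then have "h (Suc i) = -2 * real (catalan i)" "h (Suc (m - i)) = -2 * real (catalan (m - i))"
        using less[of i] less[of "m - i"] Suc by (simp_all add: h_def)
      then show "h (Suc i) * h (Suc (m - i)) = 4 * (real (catalan i) * real (catalan (m - i)))" by simp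
    qed
    also have "\<dots> = 4 * real (catalan n)"
      by (simp add: Suc sum_distrib_left atLeast0AtMost)
    finally show ?thesis by (simp add: h_def)
  qed
qed

lemma central_binomial_Suc:
  "(real n + 1) * real ((2 * Suc n) choose Suc n) = (4 * real n + 2) * real ((2 * n) choose n)"
proof -
  have "Suc n * ((2 * Suc n) choose Suc n) = (2 * Suc n) * (Suc (2 * n) choose n)"
    using Suc_times_binomial[of n "Suc (2 * n)"] by simp
  then have "(2 * Suc n) choose Suc n = 2 * (Suc (2 * n) choose n)"
    by (simp only: mult.assoc mult.left_commute[of 2 "Suc n"] mult_cancel1) simp
  moreover have "Suc n * (Suc (2 * n) choose n) = Suc (2 * n) * ((2 * n) choose n)"
    using binomial_absorb_comp[of "Suc (2 * n)" n] by simp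
  ultimately have "Suc n * ((2 * Suc n) choose Suc n) = 2 * Suc (2 * n) * ((2 * n) choose n)"
    by (simp only: mult.left_commute[of "Suc n" 2] mult.assoc)
  then have "real (Suc n * ((2 * Suc n) choose Suc n)) = real (2 * Suc (2 * n) * ((2 * n) choose n))"
    by (rule arg_cong)
  then show ?thesis by (simp only: of_nat_mult of_nat_Suc) (simp add: algebra_simps)
qed

text \<open>Consecutive generalized binomial coefficients of 1/2 have a simple ratio. Together with
  \<open>central_binomial_Suc\<close> this shows that both sides of the closed form obey the same
  first-order recurrence.\<close>

lemma catalan_Suc_ratio: "(real n + 2) * real (catalan (Suc n)) = (4 * real n + 2) * real (catalan n)"
proof -
  have "(1/2 - real (Suc n)) * (1/2 gchoose Suc n) = (real (Suc n) + 1) * (1/2 gchoose Suc (Suc n))"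
    using gbinomial_mult_1[of "1/2 :: real" "Suc n"] by (simp add: algebra_simps)
  then have *: "(real n + 2) * (1/2 gchoose Suc (Suc n)) = - (4 * real n + 2) * (1/2 gchoose Suc n) / 4"
    by (simp add: algebra_simps)
  have "(real n + 2) * real (catalan (Suc n)) =
      ((real n + 2) * (1/2 gchoose Suc (Suc n))) * (-4) ^ Suc (Suc n) / (-2)"
    unfolding catalan_gbinomial by simp
  also have "\<dots> = (4 * real n + 2) * real (catalan n)"
    unfolding * catalan_gbinomial by (simp add: field_simps)
  finally show ?thesis .
qed

lemma catalan_closed_form: "real (catalan n) = 1 / (real n + 1) * real ((2 * n) choose n)"
proof (induction n)
  case (Suc n)
  have "(real n + 2) * real (catalan (Suc n)) = (4 * real n + 2) * (1 / (real n + 1) * real ((2 * n) choose n))"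
    using catalan_Suc_ratio Suc by simp
  also have "\<dots> = real ((2 * Suc n) choose Suc n)"
    using central_binomial_Suc[of n] by (simp add: field_simps del: binomial_Suc_Suc)
  finally show ?case by (simp add: field_simps del: catalan.simps binomial_Suc_Suc)
qed simp

section \<open>Max-induced subsequences as embedded trees\<close>

text \<open>The max-induced condition for one pair of consecutive positions, written without
  \<open>Max\<close> so that it can be verified entry by entry.\<close>

definition max_adj :: "(nat \<Rightarrow> 'a::linorder) \<Rightarrow> nat \<Rightarrow> nat \<Rightarrow> bool" where
  "max_adj v i j \<longleftrightarrow> (\<forall>l\<in>{i..j}. v l \<le> max (v i) (v j))"

lemma max_adj_iff:
  assumes "i \<le> j"
  shows "max_adj v i j \<longleftrightarrow> Max (v ` {i..j}) \<in> {v i, v j}"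
proof
  assume "max_adj v i j"
  then have "Max (v ` {i..j}) = max (v i) (v j)"
    using assms by (intro Max_eqI) (auto simp: max_adj_def max_def)
  then show "Max (v ` {i..j}) \<in> {v i, v j}" by (auto simp: max_def)
next
  assume M: "Max (v ` {i..j}) \<in> {v i, v j}"
  show "max_adj v i j"
    unfolding max_adj_def
  proof
    fix l assume "l \<in> {i..j}"
    then have "v l \<le> Max (v ` {i..j})" by simp
    also have "\<dots> \<le> max (v i) (v j)" using M by auto
    finally show "v l \<le> max (v i) (v j)" .
  qed
qed

lemma max_induced_iff:
  "max_induced xs is \<longleftrightarrow> subseq_positions xs is \<and> successively (max_adj ((!) xs)) is"
proof (cases "subseq_positions xs is")
  case True
  then have "is ! j \<le> is ! Suc j" if "Suc j < length is" for j
    using that sorted_wrt_nth_less[of "(<)" "is" j "Suc j"]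
    by (auto simp: subseq_positions_def)
  then show ?thesis
    using True by (simp add: max_induced_def successively_conv_nth max_adj_iff)
qed (simp add: max_induced_def)

text \<open>Every subtree occupies an interval of positions, and its root label cuts that interval
  in two.\<close>

lemma inorder_Node_upt:
  assumes "inorder \<langle>l, a, r\<rangle> = [p..<q]"
  shows "inorder l = [p..<a]" "inorder r = [Suc a..<q]" "p \<le> a" "a < q"
proof -
  have eq: "inorder l @ a # inorder r = [p..<q]" using assms by simp
  then have a: "a \<in> {p..<q}" by (metis in_set_conv_decomp set_upt)
  have len: "size l + Suc (size r) = q - p"
    using arg_cong[OF eq, of length] by simp
  then have "a = [p..<q] ! size l" using eq by (metis length_inorder nth_append_length)
  then have "a = p + size l" using len by simp
  then have "[p..<q] = [p..<a] @ a # [Suc a..<q]" "length [p..<a] = size l"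
    using a upt_add_eq_append[of p a "q - a"] upt_conv_Cons[of a q] by auto
  then show "inorder l = [p..<a]" "inorder r = [Suc a..<q]"
    using eq by (metis append_eq_append_conv length_inorder list.inject)+
  show "p \<le> a" "a < q" using a by auto
qed

text \<open>The node set of \<open>s\<close> is a subset of that of \<open>t\<close> closed under lowest common ancestors.\<close>

inductive embedded :: "'a tree \<Rightarrow> 'a tree \<Rightarrow> bool" where
  Leaf: "embedded \<langle>\<rangle> t"
| left: "embedded s l \<Longrightarrow> embedded s \<langle>l, a, r\<rangle>"
| right: "embedded s r \<Longrightarrow> embedded s \<langle>l, a, r\<rangle>"
| Node: "embedded s l \<Longrightarrow> embedded s' r \<Longrightarrow> embedded \<langle>s, a, s'\<rangle> \<langle>l, a, r\<rangle>"

lemma embedded_set: "embedded s t \<Longrightarrow> set_tree s \<subseteq> set_tree t"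
  by (induction rule: embedded.induct) auto

lemma embedded_bst: "embedded s t \<Longrightarrow> bst_wrt P t \<Longrightarrow> bst_wrt P s"
  by (induction rule: embedded.induct) (auto dest: embedded_set)

lemma embedded_max_heap:
  "embedded s t \<Longrightarrow> max_heap (map_tree v t) \<Longrightarrow> max_heap (map_tree v s)"
  by (induction rule: embedded.induct) (auto simp: tree.set_map dest: embedded_set)

text \<open>When \<open>a\<close> is kept, the only new consecutive pairs are those ending or
  starting at \<open>a\<close>. All positions between lie in the interval of the subtree rooted at
  \<open>a\<close>, where \<open>v a\<close> is maximal.\<close>

lemma embedded_successively_max_adj:
  assumes "embedded s t" "inorder t = [p..<q]" "max_heap (map_tree v t)"
  shows "successively (max_adj v) (inorder s)"
  using assms
proof (induction arbitrary: p q rule: embedded.induct)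
  case (left s l a r)
  then show ?case using left.IH[OF inorder_Node_upt(1)[OF left.prems(1)]] by simp
next
  case (right s r l a)
  then show ?case using right.IH[OF inorder_Node_upt(2)[OF right.prems(1)]] by simp
next
  case (Node s l s' r a)
  note upt = inorder_Node_upt[OF Node.prems(1)]
  have heap: "v x \<le> v a" if "x \<in> {p..<q}" for x
    using that Node.prems(2) unfolding set_tree_upt[OF Node.prems(1), symmetric]
    by (auto simp: tree.set_map less_imp_le)
  have "max_adj v (last (inorder s)) a" if "inorder s \<noteq> []"
  proof -
    have "last (inorder s) \<in> set_tree l"
      using last_in_set[OF that] embedded_set[OF Node.hyps(1)] by auto
    then show ?thesis
      using upt set_tree_upt[OF upt(1)] by (auto simp: max_adj_def intro!: max.coboundedI2 heap)
  qed
  moreover have "max_adj v a (hd (inorder s'))" if "inorder s' \<noteq> []"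
  proof -
    have "hd (inorder s') \<in> set_tree r"
      using hd_in_set[OF that] embedded_set[OF Node.hyps(2)] by auto
    then show ?thesis
      using upt set_tree_upt[OF upt(2)] by (auto simp: max_adj_def intro!: max.coboundedI1 heap)
  qed
  ultimately show ?case
    using Node.IH(1)[OF upt(1)] Node.IH(2)[OF upt(2)] Node.prems(2)
    by (auto simp: successively_append_iff successively_Cons)
qed simp

lemma embedded_max_induced:
  assumes "embedded s t" "inorder t = [0..<length xs]" "max_heap (map_tree ((!) xs) t)"
  shows "max_induced xs (inorder s)"
proof -
  have "sorted_wrt (<) (inorder s)"
    using embedded_bst[OF assms(1) bst_upt[OF assms(2)]] by (simp add: bst_iff_sorted_wrt_less)
  moreover have "i < length xs" if "i \<in> set_tree s" for i
    using that embedded_set[OF assms(1)] set_tree_upt[OF assms(2)] by auto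
  ultimately show ?thesis
    using embedded_successively_max_adj[OF assms] by (simp add: max_induced_iff subseq_positions_def)
qed

section \<open>Long branches, complete subtrees and the size of a tree\<close>

fun left_chain :: "'a tree \<Rightarrow> nat" where
  "left_chain \<langle>\<rangle> = 0"
| "left_chain \<langle>l, a, r\<rangle> = max (Suc (left_chain l)) (left_chain r)"

fun right_chain :: "'a tree \<Rightarrow> nat" where
  "right_chain \<langle>\<rangle> = 0"
| "right_chain \<langle>l, a, r\<rangle> = max (right_chain l) (Suc (right_chain r))"

text \<open>Keep the nodes of an optimal branch at which it goes left. Each of them follows all
  later chosen nodes in the traversal and is at least as large, so the values increase
  weakly.\<close>

lemma left_chain_embedded:
  assumes "max_heap (map_tree v t)"
  shows "\<exists>s. embedded s t \<and> size s = left_chain t \<and> sorted_wrt (\<le>) (map v (inorder s))"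
  using assms
proof (induction t)
  case Leaf
  then show ?case by (intro exI[of _ "\<langle>\<rangle>"]) (auto intro: embedded.intros)
next
  case (Node l a r)
  show ?case
  proof (cases "left_chain r \<le> Suc (left_chain l)")
    case True
    obtain s where s: "embedded s l" "size s = left_chain l" "sorted_wrt (\<le>) (map v (inorder s))"
      using Node by auto
    have "v x \<le> v a" if "x \<in> set_tree s" for x
      using that embedded_set[OF s(1)] Node.prems by (auto simp: tree.set_map less_imp_le)
    then show ?thesis
      using s True by (intro exI[of _ "\<langle>s, a, \<langle>\<rangle>\<rangle>"])
        (auto intro: embedded.intros simp: sorted_wrt_append)
  next
    case False
    then show ?thesis using Node by (auto intro: embedded.intros)
  qed
qed

lemma right_chain_embedded:
  assumes "max_heap (map_tree v t)"
  shows "\<exists>s. embedded s t \<and> size s = right_chain t \<and> sorted_wrt (\<ge>) (map v (inorder s))"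
  using assms
proof (induction t)
  case Leaf
  then show ?case by (intro exI[of _ "\<langle>\<rangle>"]) (auto intro: embedded.intros)
next
  case (Node l a r)
  show ?case
  proof (cases "right_chain l \<le> Suc (right_chain r)")
    case True
    obtain s where s: "embedded s r" "size s = right_chain r" "sorted_wrt (\<ge>) (map v (inorder s))"
      using Node by auto
    have "v x \<le> v a" if "x \<in> set_tree s" for x
      using that embedded_set[OF s(1)] Node.prems by (auto simp: tree.set_map)
    then show ?thesis
      using s True by (intro exI[of _ "\<langle>\<langle>\<rangle>, a, s\<rangle>"]) (auto intro: embedded.intros)
  next
    case False
    then show ?thesis using Node by (auto intro: embedded.intros)
  qed
qed

text \<open>The Horton-Strahler number is the height of the largest complete tree embedded in \<open>t\<close>.\<close>

fun strahler :: "'a tree \<Rightarrow> nat" where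
  "strahler \<langle>\<rangle> = 0"
| "strahler \<langle>l, a, r\<rangle> =
     (if strahler l = strahler r then Suc (strahler l) else max (strahler l) (strahler r))"

text \<open>If both sides have equal Strahler number, the root of \<open>u\<close> goes to the root
  and its subtrees, which have smaller height, go to the two sides. Otherwise the side with the
  larger number has room for all of \<open>u\<close>.\<close>

lemma strahler_embedded:
  assumes "height u \<le> strahler t"
  shows "\<exists>s. embedded s t \<and> shape s = u"
  using assms
proof (induction t arbitrary: u)
  case Leaf
  then show ?case by (auto intro: embedded.intros)
next
  case (Node l a r)
  consider "strahler l = strahler r" | "strahler r < strahler l" | "strahler l < strahler r"
    by linarith
  then show ?case
  proof cases
    case 1
    show ?thesis
    proof (cases u)
      case Leaf
      then show ?thesis by (auto intro: embedded.intros)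
    next
      case (Node u1 c u2)
      then obtain s1 s2 where "embedded s1 l" "shape s1 = u1" "embedded s2 r" "shape s2 = u2"
        using Node.IH[of u1] Node.IH[of u2] Node.prems 1 by auto
      then show ?thesis
        using Node by (intro exI[of _ "\<langle>s1, a, s2\<rangle>"]) (auto intro: embedded.intros)
    qed
  next
    case 2
    then show ?thesis using Node.IH(1)[of u] Node.prems by (auto intro: embedded.intros)
  next
    case 3
    then show ?thesis using Node.IH(2)[of u] Node.prems by (auto intro: embedded.intros)
  qed
qed

text \<open>Going to a child shortens one of the two chains, so \<open>p\<close> bounds the base for
  both children. At most one child keeps the exponent \<open>Suc d\<close>, and
  \<open>p ^ Suc d + p ^ d = (p + 1) * p ^ d\<close> is at most
  \<open>(p + 1) ^ Suc d\<close>.\<close>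

lemma size1_le_chains: "size1 t \<le> (left_chain t + right_chain t + 1) ^ strahler t"
proof (induction t)
  case (Node l a r)
  define p where "p = left_chain \<langle>l, a, r\<rangle> + right_chain \<langle>l, a, r\<rangle>"
  have p: "left_chain l + right_chain l + 1 \<le> p" "left_chain r + right_chain r + 1 \<le> p"
    by (auto simp: p_def)
  define d where "d = strahler \<langle>l, a, r\<rangle> - 1"
  have d: "strahler \<langle>l, a, r\<rangle> = Suc d"
    by (auto simp: d_def)
  have bound: "size1 t \<le> p ^ e"
    if "size1 t \<le> (left_chain t + right_chain t + 1) ^ strahler t"
      "left_chain t + right_chain t + 1 \<le> p" "strahler t \<le> e" for t :: "'a tree" and e
  proof -
    note that(1)
    also have "(left_chain t + right_chain t + 1) ^ strahler t \<le> p ^ strahler t"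
      using that(2) by (rule power_mono) simp
    also have "\<dots> \<le> p ^ e" using that by (intro power_increasing) auto
    finally show ?thesis .
  qed
  have "strahler l \<le> Suc d \<and> strahler r \<le> d \<or> strahler l \<le> d \<and> strahler r \<le> Suc d"
    using d by (auto split: if_splits)
  then have "size1 \<langle>l, a, r\<rangle> \<le> p ^ Suc d + p ^ d"
    using bound[OF Node.IH(1) p(1)] bound[OF Node.IH(2) p(2)]
    by (metis add.commute add_mono size1.simps(2))
  also have "\<dots> = (p + 1) * p ^ d" by simp
  also have "\<dots> \<le> (p + 1) * (p + 1) ^ d"
    by (intro mult_le_mono2 power_mono) auto
  finally show ?case unfolding d p_def by simp
qed simp

section \<open>Counting max-induced patterns\<close>

lemma patterns_eq_class:
  assumes "P \<in> patterns k" "ys \<in> P"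
  shows "length ys = k" "P = pattern_rel k `` {ys}"
proof -
  obtain zs where zs: "P = pattern_rel k `` {zs}"
    using assms(1) unfolding patterns_def by (rule quotientE)
  then have rel: "(zs, ys) \<in> pattern_rel k" using assms(2) by simp
  then show "P = pattern_rel k `` {ys}"
    unfolding zs by (rule equiv_class_eq[OF equiv_pattern_rel])
  show "length ys = k" using rel by (simp add: pattern_rel_def same_pattern_def)
qed

lemma finite_subseq_positions: "finite {is. subseq_positions xs is}"
proof (rule finite_subset)
  show "{is. subseq_positions xs is} \<subseteq> sorted_list_of_set ` Pow {..<length xs}"
  proof
    fix "is" assume "is \<in> {is. subseq_positions xs is}"
    then have "sorted_wrt (<) is" "set is \<subseteq> {..<length xs}" by (auto simp: subseq_positions_def)
    then show "is \<in> sorted_list_of_set ` Pow {..<length xs}"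
      by (intro image_eqI[of _ _ "set is"]) (simp_all add: strict_sorted_iff sorted_list_of_set.idem_if_sorted_distinct)
  qed
qed simp

text \<open>There are finitely many position lists. Finiteness matters for the lower bound, as
  \<open>card\<close> of an infinite set is 0.\<close>

lemma finite_contained_patterns: "finite {P \<in> patterns k. contains_max_induced_pattern xs P}"
proof (rule finite_subset)
  show "{P \<in> patterns k. contains_max_induced_pattern xs P}
      \<subseteq> (\<lambda>is. pattern_rel k `` {map ((!) xs) is}) ` {is. subseq_positions xs is}"
    using patterns_eq_class(2)
    by (fastforce simp: contains_max_induced_pattern_def max_induced_def)
qed (simp add: finite_subseq_positions)

text \<open>A shape with \<open>k\<close> nodes has height at most \<open>k\<close>, hence embeds
  into \<open>t\<close>. Its traversal is max-induced, and distinct shapes give distinct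
  patterns.\<close>

lemma catalan_le_contained_patterns:
  fixes xs :: "'a::linorder list"
  assumes t: "inorder t = [0..<length xs]" "max_heap (map_tree ((!) xs) t)"
    and k: "k \<le> strahler t"
  shows "catalan k \<le> card {P \<in> patterns k. contains_max_induced_pattern xs P}"
proof -
  \<comment> \<open>Trees with \<open>unit\<close> labels are their own shapes, so this is the set
    of all shapes with \<open>k\<close> nodes.\<close>
  let ?U = "{u. inorder u = replicate k ()}"
  have size: "size u = k" if "u \<in> ?U" for u
    using that by (metis length_inorder length_replicate mem_Collect_eq)
  have "\<forall>u\<in>?U. \<exists>s. embedded s t \<and> shape s = u"
  proof
    fix u assume "u \<in> ?U"
    then have "height u \<le> strahler t"
      using size[of u] height_le_size_tree[of u] k by simp
    then show "\<exists>s. embedded s t \<and> shape s = u" by (rule strahler_embedded)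
  qed
  then obtain f where f: "\<forall>u\<in>?U. embedded (f u) t \<and> shape (f u) = u"
    by (rule bchoice[THEN exE])
  define g where "g u = map ((!) xs) (inorder (f u))" for u
  have len: "length (g u) = k" if "u \<in> ?U" for u
    using f that size[OF that] by (metis g_def length_inorder length_map size_map_tree)
  have inj: "inj_on (\<lambda>u. pattern_rel k `` {g u}) ?U"
  proof (rule inj_onI)
    fix u w assume u: "u \<in> ?U" and w: "w \<in> ?U" and "pattern_rel k `` {g u} = pattern_rel k `` {g w}"
    then have "(g u, g w) \<in> pattern_rel k"
      using len by (auto simp: eq_equiv_class_iff[OF equiv_pattern_rel])
    then have "same_pattern (inorder (map_tree ((!) xs) (f u))) (inorder (map_tree ((!) xs) (f w)))"
      by (simp add: pattern_rel_def g_def inorder_map)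
    then have "shape (map_tree ((!) xs) (f u)) = shape (map_tree ((!) xs) (f w))"
      using f u w t(2) by (intro max_heap_shape_unique) (auto intro: embedded_max_heap)
    then have "shape (f u) = shape (f w)" by (simp add: tree.map_comp comp_def)
    then show "u = w" using f u w by auto
  qed
  have "(\<lambda>u. pattern_rel k `` {g u}) ` ?U \<subseteq> {P \<in> patterns k. contains_max_induced_pattern xs P}"
  proof
    fix P assume "P \<in> (\<lambda>u. pattern_rel k `` {g u}) ` ?U"
    then obtain u where u: "u \<in> ?U" and P: "P = pattern_rel k `` {g u}" by blast
    have "P \<in> patterns k"
      unfolding patterns_def P by (rule quotientI) (simp add: len[OF u])
    moreover have "max_induced xs (inorder (f u))"
      using f u t by (intro embedded_max_induced) auto
    moreover have "g u \<in> P"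
      by (simp add: P pattern_rel_def len[OF u] same_pattern_refl)
    ultimately show "P \<in> {P \<in> patterns k. contains_max_induced_pattern xs P}"
      by (auto simp: contains_max_induced_pattern_def g_def)
  qed
  from card_inj_on_le[OF inj this finite_contained_patterns] show ?thesis
    by (simp add: card_trees_inorder)
qed

lemma monotonic_max_induced_exists:
  assumes "inorder t = [0..<length xs]" "max_heap (map_tree ((!) xs) t)"
  shows "\<exists>is. max_induced xs is \<and> monotonic (map ((!) xs) is) \<and>
           length is = max (left_chain t) (right_chain t)"
proof (cases "right_chain t \<le> left_chain t")
  case True
  obtain s where "embedded s t" "size s = left_chain t" "sorted_wrt (\<le>) (map ((!) xs) (inorder s))"
    using left_chain_embedded[OF assms(2)] by blast
  then show ?thesis
    using True embedded_max_induced[OF _ assms] by (intro exI[of _ "inorder s"]) (simp add: monotonic_def)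
next
  case False
  obtain s where "embedded s t" "size s = right_chain t" "sorted_wrt (\<ge>) (map ((!) xs) (inorder s))"
    using right_chain_embedded[OF assms(2)] by blast
  then show ?thesis
    using False embedded_max_induced[OF _ assms] by (intro exI[of _ "inorder s"]) (simp add: monotonic_def)
qed

lemma chains_eq_0_iff: "left_chain t = 0 \<longleftrightarrow> t = \<langle>\<rangle>" "right_chain t = 0 \<longleftrightarrow> t = \<langle>\<rangle>"
  by (cases t; simp)+

lemma size_le_1_if_chains_le_1: "left_chain t \<le> 1 \<Longrightarrow> right_chain t \<le> 1 \<Longrightarrow> size t \<le> 1"
  by (cases t) (auto simp: chains_eq_0_iff)

text \<open>Let \<open>m\<close> be the longer chain. If \<open>m \<ge> 2\<close>, the base in
  \<open>size1_le_chains\<close> is at most \<open>2 * m + 1\<close>, hence at most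
  \<open>m ^ 3\<close>, which explains the exponent. If \<open>m \<le> 1\<close>, the tree has at
  most one node.\<close>

lemma size_powr_le_chains:
  assumes "strahler t \<le> k" "k \<ge> 1"
  shows "real (size t) powr (1 / (3 * real k)) \<le> max (left_chain t) (right_chain t)"
proof (cases "max (left_chain t) (right_chain t) \<le> 1")
  case True
  then have "size t \<le> 1" by (intro size_le_1_if_chains_le_1) auto
  \<comment> \<open>The empty tree causes no trouble, as \<open>0 powr x\<close> is 0.\<close>
  then consider "size t = 0" | "size t = 1" by linarith
  then show ?thesis
  proof cases
    case 2
    then have "t \<noteq> \<langle>\<rangle>" by auto
    then show ?thesis using 2 chains_eq_0_iff(1)[of t] by simp
  qed simp
next
  case False
  define m where "m = max (left_chain t) (right_chain t)"
  have m: "m \<ge> 2" using False by (simp only: m_def not_le)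
  have "left_chain t + right_chain t + 1 \<le> 2 * m + 1"
    by (simp add: m_def)
  also have "\<dots> \<le> 4 * m" using m by simp
  also have "\<dots> \<le> m ^ 3"
  proof -
    have "4 * m \<le> (m * m) * m" using mult_le_mono[OF m m] by (intro mult_le_mono1) simp
    then show ?thesis by (simp add: power3_eq_cube)
  qed
  finally have le: "left_chain t + right_chain t + 1 \<le> m ^ 3" .
  have "size t \<le> size1 t" by (simp add: size1_size)
  also have "\<dots> \<le> (left_chain t + right_chain t + 1) ^ strahler t" by (rule size1_le_chains)
  also have "\<dots> \<le> (m ^ 3) ^ strahler t" using le by (rule power_mono) simp
  also have "\<dots> \<le> (m ^ 3) ^ k" using assms(1) m by (intro power_increasing) auto
  finally have "real (size t) \<le> real ((m ^ 3) ^ k)" by (rule of_nat_mono)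
  then have "real (size t) powr (1 / (3 * real k)) \<le> real ((m ^ 3) ^ k) powr (1 / (3 * real k))"
    by (intro powr_mono2) auto
  also have "real ((m ^ 3) ^ k) = real m powr (3 * real k)"
    using m powr_realpow[of "real m" "3 * k"] by (simp add: power_mult)
  also have "\<dots> powr (1 / (3 * real k)) = real m"
    using assms(2) m by (simp add: powr_powr)
  finally show ?thesis unfolding m_def .
qed

lemma guaranteed_catalan:
  assumes "k \<ge> 1"
  shows "guaranteed TYPE('a::linorder) k (catalan k)"
  unfolding guaranteed_def
proof (intro exI[of _ "1 / (3 * real k)"] conjI allI impI)
  show "1 / (3 * real k) > 0" using assms by simp
  fix n and xs :: "'a list"
  assume n: "length xs = n"
  obtain t where t: "inorder t = [0..<length xs]" "max_heap (map_tree ((!) xs) t)"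
    using max_heap_exists by blast
  have size: "size t = n" using arg_cong[OF t(1), of length] n by simp
  show "catalan k \<le> card {P \<in> patterns k. contains_max_induced_pattern xs P} \<or>
    (\<exists>is. max_induced xs is \<and> monotonic (map ((!) xs) is) \<and> real n powr (1 / (3 * real k)) \<le> real (length is))"
  proof (cases "k \<le> strahler t")
    case True
    then show ?thesis using catalan_le_contained_patterns[OF t] by blast
  next
    case False
    then have "real n powr (1 / (3 * real k)) \<le> max (left_chain t) (right_chain t)"
      using size_powr_le_chains[of t k] assms size by simp
    then show ?thesis using monotonic_max_induced_exists[OF t] by metis
  qed
qed

section \<open>Upper bound: sequences with few patterns and short monotonic subsequences\<close>

lemma monotonic_append: "monotonic (xs @ ys) \<Longrightarrow> monotonic xs \<and> monotonic ys"
  by (auto simp: monotonic_def sorted_wrt_append)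

text \<open>Using the root \<open>a\<close> leaves one side empty, since smaller entries on both
  sides of it would break monotonicity. Skipping \<open>a\<close> also confines the positions to one
  side, since a pair jumping over \<open>a\<close> would miss the maximum. Injectivity makes these
  inequalities strict on the right as well.\<close>

lemma monotonic_max_adj_le_height:
  assumes "inorder t = [p..<q]" "max_heap (map_tree v t)" "inj_on v (set_tree t)"
    and "sorted_wrt (<) is" "set is \<subseteq> set_tree t" "successively (max_adj v) is"
    and "monotonic (map v is)"
  shows "length is \<le> height t"
  using assms
proof (induction t arbitrary: p q "is")
  case (Node l a r)
  note upt = inorder_Node_upt[OF Node.prems(1)]
  have L: "set_tree l = {p..<a}" and R: "set_tree r = {Suc a..<q}"
    using set_tree_upt upt by blast+
  have less: "v x < v a" if "x \<in> set_tree l \<union> set_tree r" for x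
  proof (rule le_neq_trans)
    show "v x \<le> v a" using that Node.prems(2) by (auto simp: tree.set_map less_imp_le)
    have "x \<noteq> a" using that L R by auto
    then show "v x \<noteq> v a" using inj_onD[OF Node.prems(3), of x a] that by auto
  qed
  have inj: "inj_on v (set_tree l)" "inj_on v (set_tree r)"
    using Node.prems(3) by (auto elim: inj_on_subset)
  have IHl: "length js \<le> height l"
    if "sorted_wrt (<) js" "set js \<subseteq> set_tree l" "successively (max_adj v) js" "monotonic (map v js)" for js
    using Node.IH(1)[OF upt(1) _ inj(1)] that Node.prems(2) by simp
  have IHr: "length js \<le> height r"
    if "sorted_wrt (<) js" "set js \<subseteq> set_tree r" "successively (max_adj v) js" "monotonic (map v js)" for js
    using Node.IH(2)[OF upt(2) _ inj(2)] that Node.prems(2) by simp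
  have sets: "x \<in> set_tree l \<longleftrightarrow> x < a" "x \<in> set_tree r \<longleftrightarrow> a < x" if "x \<in> set is" for x
    using Node.prems(5) that L R by auto
  show ?case
  proof (cases "a \<in> set is")
    case True
    then obtain A B where is_eq: "is = A @ a # B" by (meson split_list)
    have sub: "set A \<subseteq> set_tree l" "set B \<subseteq> set_tree r"
    proof -
      have "x < a" if "x \<in> set A" for x using that Node.prems(4) by (simp add: is_eq sorted_wrt_append)
      moreover have "a < x" if "x \<in> set B" for x
        using that Node.prems(4) by (simp add: is_eq sorted_wrt_append)
      ultimately show "set A \<subseteq> set_tree l" "set B \<subseteq> set_tree r"
        using sets by (simp_all add: is_eq subset_iff)
    qed
    have mono: "monotonic (map v A)" "monotonic (map v B)"
      using Node.prems(7) monotonic_append[of "map v A" "v a # map v B"]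
        monotonic_append[of "map v A @ [v a]" "map v B"] by (simp_all add: is_eq)
    have "length A \<le> height l" "length B \<le> height r"
      using IHl[of A] IHr[of B] sub mono Node.prems(4,6)
      by (auto simp: is_eq sorted_wrt_append successively_append_iff successively_Cons)
    moreover have "A = [] \<or> B = []"
    proof (rule ccontr)
      assume "\<not> (A = [] \<or> B = [])"
      then obtain x y where "x \<in> set A" "y \<in> set B" by (metis last_in_set)
      moreover from this have "v x < v a" "v y < v a" using less sub by auto
      ultimately show False
        using Node.prems(7) by (auto simp: is_eq monotonic_def sorted_wrt_append)
    qed
    ultimately show ?thesis by (auto simp: is_eq)
  next
    case False
    define A where "A = takeWhile (\<lambda>x. x < a) is"
    define B where "B = dropWhile (\<lambda>x. x < a) is"
    have is_eq: "is = A @ B" by (simp add: A_def B_def)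
    show ?thesis
    proof (cases "B = []")
      case True
      then have "\<forall>x\<in>set is. x < a" by (simp add: B_def dropWhile_eq_Nil_conv)
      then have "set is \<subseteq> set_tree l" using sets by blast
      then have "length is \<le> height l" using IHl Node.prems by blast
      then show ?thesis by simp
    next
      case B: False
      then have "\<not> hd B < a" unfolding B_def by (rule hd_dropWhile)
      moreover have hdB: "hd B \<in> set is" using B by (simp add: is_eq)
      ultimately have aB: "a < hd B" using False by (metis linorder_neqE_nat)
      have "A = []"
      proof (rule ccontr)
        assume A: "A \<noteq> []"
        then have "last A \<in> set (takeWhile (\<lambda>x. x < a) is)" by (simp add: A_def)
        then have lA: "last A < a" "last A \<in> set is" by (auto dest: set_takeWhileD)
        have "max_adj v (last A) (hd B)"
          using Node.prems(6) A B by (simp add: is_eq successively_append_iff)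
        then have "v a \<le> max (v (last A)) (v (hd B))"
          using lA aB by (auto simp: max_adj_def)
        moreover have "v (last A) < v a" "v (hd B) < v a"
          using less sets lA aB hdB by blast+
        ultimately show False by (auto simp: le_max_iff_disj)
      qed
      then have "is = hd B # tl B" using B by (simp add: is_eq)
      then have "\<forall>x\<in>set is. a < x"
        using Node.prems(4) aB by (metis less_trans set_ConsD sorted_wrt.simps(2))
      then have "set is \<subseteq> set_tree r" using sets by blast
      then have "length is \<le> height r" using IHr Node.prems by blast
      then show ?thesis by simp
    qed
  qed
qed simp

lemma complete_tree_exists: "\<exists>t. inorder t = [p..<p + (2 ^ d - 1)] \<and> height t = d"
proof (induction d arbitrary: p)
  case 0
  then show ?case by (intro exI[of _ "\<langle>\<rangle>"]) simp
next
  case (Suc d)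
  define n :: nat where "n = 2 ^ d - 1"
  obtain l r where "inorder l = [p..<p + n]" "height l = d"
    "inorder r = [Suc (p + n)..<Suc (p + n) + n]" "height r = d"
    using Suc[of p] Suc[of "Suc (p + n)"] unfolding n_def by blast
  moreover have "(2::nat) ^ Suc d - 1 = n + Suc n" by (simp add: n_def)
  moreover have "[p..<p + (n + Suc n)] = [p..<p + n] @ (p + n) # [Suc (p + n)..<Suc (p + n) + n]"
    using upt_add_eq_append[of p "p + n" "Suc n"] upt_conv_Cons[of "p + n" "p + n + Suc n"]
    by (simp only: add_Suc add_Suc_right add.assoc le_add1 less_add_Suc1 simp_thms)
  ultimately show ?case by (intro exI[of _ "\<langle>l, p + n, r\<rangle>"]) simp
qed

text \<open>Every pattern that occurs, max-induced or not, is the pattern of the standardization of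
  a subsequence, which is a permutation avoiding \<open>q\<close>.\<close>

lemma card_contained_patterns_le:
  fixes xs :: "'a::linorder list"
  assumes "distinct xs" "avoids xs q"
  shows "card {P \<in> patterns k. contains_max_induced_pattern xs P} \<le> card (avoiding_perms k q)"
proof (rule surj_card_le[OF finite_avoiding_perms])
  \<comment> \<open>The class of \<open>p\<close> is written with \<open>same_pattern\<close>
    because \<open>p\<close> is a list of naturals while the members of \<open>P\<close> have
    entries in \<open>'a\<close>.\<close>
  show "{P \<in> patterns k. contains_max_induced_pattern xs P}
      \<subseteq> (\<lambda>p. {zs. length zs = k \<and> same_pattern p zs}) ` avoiding_perms k q"
  proof
    fix P assume "P \<in> {P \<in> patterns k. contains_max_induced_pattern xs P}"
    then obtain "is" where P: "P \<in> patterns k" and pos: "subseq_positions xs is"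
      and ys: "map ((!) xs) is \<in> P"
      by (auto simp: contains_max_induced_pattern_def max_induced_def)
    define ys where "ys = map ((!) xs) is"
    have len: "length ys = k" and P_eq: "P = pattern_rel k `` {ys}"
      using patterns_eq_class[OF P ys] by (simp_all add: ys_def)
    have sub: "subseq ys xs" using pos by (auto simp: subseq_iff_positions ys_def)
    then have "distinct ys" using assms(1) by (auto simp: subseq_conv_nths)
    then have "standardize ys \<in> avoiding_perms k q"
      using standardize_in_permutations[of ys] len
        avoids_same_pattern[OF same_pattern_standardize avoids_subseq[OF sub assms(2)]]
      by (simp add: avoiding_perms_def)
    moreover have "P = {zs. length zs = k \<and> same_pattern (standardize ys) zs}"
    proof -
      have "same_pattern ys zs \<longleftrightarrow> same_pattern (standardize ys) zs" for zs :: "'a list"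
        using same_pattern_trans[OF same_pattern_standardize]
          same_pattern_trans[OF same_pattern_sym[OF same_pattern_standardize]] by blast
      moreover have "length zs = k" if "same_pattern ys zs" for zs :: "'a list"
        using same_pattern_length[OF that] len by simp
      ultimately show ?thesis
        unfolding P_eq pattern_rel_def using len by blast
    qed
    ultimately show "P \<in> (\<lambda>p. {zs. length zs = k \<and> same_pattern p zs}) ` avoiding_perms k q"
      by blast
  qed
qed

lemma max_heap_same_order:
  assumes "\<And>i j. i \<in> set_tree t \<Longrightarrow> j \<in> set_tree t \<Longrightarrow> v i < v j \<longleftrightarrow> w i < w j"
    and "max_heap (map_tree v t)"
  shows "max_heap (map_tree w t)"
  using assms
proof (induction t)
  case (Node l a r)
  have "w x < w a" if "x \<in> set_tree l" for x
    using Node.prems(1)[of x a] Node.prems(2) that by (simp add: tree.set_map)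
  moreover have "w x \<le> w a" if "x \<in> set_tree r" for x
    using Node.prems(1)[of a x] Node.prems(2) that by (simp add: tree.set_map flip: not_less)
  ultimately show ?case using Node by (simp add: tree.set_map)
qed simp

text \<open>An infinite order need not contain an increasing copy of the naturals, but it has
  arbitrarily long finite chains; the entries of \<open>ys\<close> serve as indices into such a
  chain.\<close>

lemma realize_pattern:
  fixes ys :: "nat list"
  assumes "infinite (UNIV :: 'a::linorder set)"
  shows "\<exists>xs :: 'a list. same_pattern xs ys"
proof -
  \<comment> \<open>Inserting 0 keeps \<open>Max\<close> defined when \<open>ys\<close> is
    empty.\<close>
  define N where "N = Suc (Max (insert 0 (set ys)))"
  obtain S :: "'a set" where S: "finite S" "card S = N"
    using infinite_arbitrarily_large[OF assms] by blast
  define zs where "zs = sorted_list_of_set S"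
  have zs: "sorted_wrt (<) zs" "length zs = N" using S by (simp_all add: zs_def)
  have mono: "zs ! i < zs ! j \<longleftrightarrow> i < j" if "i < N" "j < N" for i j
    using sorted_wrt_nth_less[OF zs(1), of i j] sorted_wrt_nth_less[OF zs(1), of j i] that zs(2)
    by (cases i j rule: linorder_cases) auto
  have "y < N" if "y \<in> set ys" for y
    using that by (simp add: N_def less_Suc_eq_le)
  then have "same_pattern (map ((!) zs) ys) ys"
    by (simp add: same_pattern_iff_less mono)
  then show ?thesis by blast
qed

lemma guaranteed_le:
  assumes "infinite (UNIV :: 'a::linorder set)" "guaranteed TYPE('a) k m"
  shows "m \<le> card (avoiding_perms k [1, 3, 2])"
proof -
  obtain \<epsilon> :: real where eps: "\<epsilon> > 0" and
    g: "\<And>xs :: 'a list. m \<le> card {P \<in> patterns k. contains_max_induced_pattern xs P} \<or>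
        (\<exists>is. max_induced xs is \<and> monotonic (map ((!) xs) is) \<and>
              real (length xs) powr \<epsilon> \<le> real (length is))"
    using assms(2) unfolding guaranteed_def by blast
  \<comment> \<open>For any fixed \<open>\<epsilon>\<close> the length \<open>2 ^ d - 1\<close>
    raised to \<open>\<epsilon>\<close> outgrows the height \<open>d\<close>, which bounds the
    monotonic max-induced subsequences.\<close>
  have "eventually (\<lambda>d::nat. real d < (2 ^ d - 1) powr \<epsilon>) at_top"
    using eps by real_asymp
  then obtain d :: nat where "real d < (2 ^ d - 1) powr \<epsilon>"
    using eventually_happens'[OF sequentially_bot] by blast
  moreover define n :: nat where "n = 2 ^ d - 1"
  ultimately have d: "real d < real n powr \<epsilon>" by (simp add: of_nat_diff)
  obtain t where t: "inorder t = [0..<n]" "height t = d"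
    using complete_tree_exists[of 0 d] by (auto simp: n_def)
  note bst = bst_upt[OF t(1)] and set = set_tree_upt[OF t(1)]
  obtain xs :: "'a list" where pat: "same_pattern xs (map (val132 t) [0..<n])"
    using realize_pattern[OF assms(1)] by blast
  have len: "length xs = n" using same_pattern_length[OF pat] by simp
  have ord: "val132 t i < val132 t j \<longleftrightarrow> xs ! i < xs ! j" if "i < n" "j < n" for i j
    using pat that len by (simp add: same_pattern_iff_less)
  have heap: "max_heap (map_tree ((!) xs) t)"
    using ord by (intro max_heap_same_order[OF _ val132_max_heap[OF bst]]) (simp add: set)
  have inj: "inj_on ((!) xs) (set_tree t)"
  proof (rule inj_onI)
    fix i j assume "i \<in> set_tree t" "j \<in> set_tree t" "xs ! i = xs ! j"
    then have "val132 t i = val132 t j"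
      using ord[of i j] ord[of j i] by (simp add: set)
    then show "i = j"
      using \<open>i \<in> set_tree t\<close> \<open>j \<in> set_tree t\<close> val132_inj[OF bst] by (simp add: inj_onD)
  qed
  have dist: "distinct xs"
    using inj len by (auto simp: set distinct_conv_nth inj_on_def)
  have av: "avoids xs [1, 3, 2::nat]"
    using avoids_same_pattern[OF pat avoids_val132[OF t(1)]] .
  \<comment> \<open>This excludes the monotonic alternative of the guarantee, so the pattern count
    of \<open>xs\<close> must reach \<open>m\<close>.\<close>
  have "length is \<le> d" if "max_induced xs is" "monotonic (map ((!) xs) is)" for "is"
    using monotonic_max_adj_le_height[OF t(1) heap inj, of "is"] that t(2) len
    by (auto simp: max_induced_iff subseq_positions_def set subset_iff)
  then have "m \<le> card {P \<in> patterns k. contains_max_induced_pattern xs P}"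
    using g[of xs] d len by force
  also have "\<dots> \<le> card (avoiding_perms k [1, 3, 2])"
    using dist av by (rule card_contained_patterns_le)
  finally show ?thesis .
qed

theorem corollary2p4:
  fixes k :: nat
  assumes "k \<ge> 1"
    and "infinite (UNIV :: 'a::linorder set)"
  shows "is_largest_guaranteed TYPE('a) k (card (avoiding_perms k [1, 3, 2])) \<and>
         card (avoiding_perms k [1, 3, 2]) = card (avoiding_perms k [2, 3, 1]) \<and>
         real (card (avoiding_perms k [1, 3, 2])) = 1 / (real k + 1) * real ((2 * k) choose k)"
proof -
  have catalan: "card (avoiding_perms k [1, 3, 2]) = catalan k"
    unfolding card_avoiding_perms_132 card_trees_inorder by simp
  have "card (avoiding_perms k [1, 3, 2]) = card (avoiding_perms k [2, 3, 1])"
    using card_avoiding_perms_rev[of k "[1, 3, 2]"] by simp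
  then show ?thesis
    using guaranteed_catalan[OF assms(1), where 'a = 'a] guaranteed_le[OF assms(2)] catalan
      catalan_closed_form[of k]
    unfolding is_largest_guaranteed_def by metis
qed

end
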